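(* Let $n=2q$ with $q\geq 1$ an integer, and let $k>0$ be real. Then, for any integer $M\ge 0$, there exist real coefficients $(a_j^{(q,k,M)})_{j=0}^M$, depending only on $q,k,M$, such that $a_M^{(q,k,M)}=1$ and, for every $\xi\in[0,\pi]$, with $b_s := \cos\left(\frac{\xi+2\pi s}{2q}\right)$ for $s=1,\ldots,2q$, $$C_M^{(k)}(\cos\xi) = \sum_{j=0}^M a_j^{(q,k,M)}\,2^{2qj} \sum_{\substack{j_1,\ldots,j_{2q}\ge 0\\ j_1+\cdots+j_{2q}=2qj}} (k)_{j_1}\cdots(k)_{j_{2q}}\,\frac{b_1^{j_1}}{j_1!}\cdots\frac{b_{2q}^{j_{2q}}}{j_{2q}!}.$$
   Context: $(x)_l := x(x+1)\cdots(x+l-1)$, with $(x)_0 := 1$, is the Pochhammer symbol. For $k>0$ and an integer $j\ge 0$, $C_j^{(k)}$ is the $j$-th Gegenbauer polynomial of parameter $k$, determined by $\sum_{j\ge 0} C_j^{(k)}(\cos\xi)\,w^j = (1-2w\cos\xi+w^2)^{-k}$ for $|w|<1$; equivalently $C_j^{(k)}(x) = \frac{(2k)_j}{j!}\,{}_2F_1\left(-j,j+2k;k+\tfrac12;\tfrac{1-x}{2}\right)$. *)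

theory Defs
  imports "HOL-Complex_Analysis.Complex_Analysis"
begin

text \<open>
  The coefficient of \<open>w ^ j\<close> in the formal power series \<open>(1 - 2 x w + w\<^sup>2) ^ (-k)\<close>, where
  \<^term>\<open>fps_binomial (-k)\<close> is the binomial series \<open>(1 + u) ^ (-k)\<close>.  The lemma
  \<open>gegenbauer_sums\<close> below is the analytic version of the generating function identity.
\<close>

definition gegenbauer :: "real \<Rightarrow> nat \<Rightarrow> real \<Rightarrow> real" where
  "gegenbauer k j x =
     fps_nth (fps_compose (fps_binomial (-k)) (fps_X\<^sup>2 - fps_const (2 * x) * fps_X)) j"

lemma gegenbauer_sums:
  fixes k \<xi> w :: real
  assumes "\<bar>w\<bar> < 1"
  shows "(\<lambda>j. gegenbauer k j (cos \<xi>) * w ^ j) sums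
           ((1 - 2 * w * cos \<xi> + w\<^sup>2) powr (-k))"
proof -
  define c where "c = cos \<xi>"
  define g where "g = (\<lambda>z::complex. z^2 - of_real (2*c) * z)"
  define G where "G = (fps_X^2 - fps_const (of_real (2*c)) * fps_X :: complex fps)"
  define F where "F = fps_compose (fps_binomial (of_real (-k))) G"
  define f where "f = (\<lambda>z. (1 + g z) powr (of_real (-k) :: complex))"
  have "g has_fps_expansion G"
    unfolding g_def G_def by (intro fps_expansion_intros)
  moreover have "fps_nth G 0 = 0"
    by (simp add: G_def)
  ultimately have "((\<lambda>z::complex. (1 + z) powr (of_real (-k))) \<circ> g) has_fps_expansion F"
    unfolding F_def by (intro has_fps_expansion_compose has_fps_expansion_binomial_complex)
  then have exp: "f has_fps_expansion F"
    by (simp add: f_def o_def)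
  have c1: "\<bar>c\<bar> \<le> 1"
    by (simp add: c_def)
  have nonneg: "1 + g z \<notin> \<real>\<^sub>\<le>\<^sub>0" if z: "norm z < 1" for z
  proof
    assume "1 + g z \<in> \<real>\<^sub>\<le>\<^sub>0"
    then have im: "Im z * (Re z - c) = 0" and re: "1 + (Re z)^2 - (Im z)^2 - 2 * c * Re z \<le> 0"
      by (auto simp: complex_nonpos_Reals_iff g_def power2_eq_square algebra_simps)
    have n: "(Re z)^2 + (Im z)^2 < 1"
      using z by (simp add: cmod_def)
    from im consider "Im z = 0" | "Re z = c" by auto
    then show False
    proof cases
      case 1
      have "(Re z)^2 < 1" using n 1 by simp
      then have "\<bar>Re z\<bar> < 1" by (simp add: abs_square_less_1)
      moreover have "c^2 \<le> 1" using c1 by (simp add: abs_square_le_1)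
      moreover have "(Re z - c)^2 + (1 - c^2) \<le> 0"
        using re 1 by (simp add: power2_eq_square algebra_simps)
      ultimately have "(Re z - c)^2 = 0" "c^2 = 1"
        using zero_le_power2[of "Re z - c"] by linarith+
      then show False using \<open>(Re z)^2 < 1\<close> by simp
    next
      case 2
      then show False using n re by (simp add: power2_eq_square)
    qed
  qed
  have holo: "f holomorphic_on eball 0 1"
    unfolding f_def using nonneg
    by (intro holomorphic_intros) (auto simp: g_def in_eball_iff intro!: holomorphic_intros)
  have "fps_expansion f 0 = F"
    using exp by (rule fps_expansion_eqI)
  then have rad: "fps_conv_radius F \<ge> 1" and ev: "\<And>z. z \<in> eball 0 1 \<Longrightarrow> eval_fps F z = f z"
    using conv_radius_fps_expansion[OF holo] eval_fps_expansion'[OF holo] by auto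
  have "norm (complex_of_real w) < fps_conv_radius F"
    using assms less_le_trans[OF _ rad, of "ereal \<bar>w\<bar>"] by simp
  then have "(\<lambda>j. fps_nth F j * of_real w ^ j) sums eval_fps F (of_real w)"
    by (rule sums_eval_fps)
  also have "eval_fps F (of_real w) = f (of_real w)"
    using assms by (intro ev) (simp add: in_eball_iff)
  also have "f (of_real w) = of_real ((1 - 2 * w * c + w^2) powr (-k))"
  proof -
    have "1 + g (of_real w) = of_real (1 - 2 * w * c + w^2)"
      by (simp add: g_def algebra_simps)
    moreover have "1 - 2 * w * c + w^2 \<ge> 0"
    proof -
      have "1 - 2 * w * c + w^2 = (w - c)^2 + (1 - c^2)"
        by (simp add: power2_eq_square algebra_simps)
      moreover have "c^2 \<le> 1" using c1 by (simp add: abs_square_le_1)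
      ultimately show ?thesis using zero_le_power2[of "w - c"] by linarith
    qed
    ultimately show ?thesis
      unfolding f_def by (simp only: powr_of_real)
  qed
  also have "(\<lambda>j. fps_nth F j * of_real w ^ j) =
      (\<lambda>j. of_real (gegenbauer k j c * w ^ j))"
  proof
    fix j
    have "fps_nth (G ^ i) m = of_real (fps_nth ((fps_X\<^sup>2 - fps_const (2 * c) * fps_X) ^ i) m)" for i m
    proof (induction i arbitrary: m)
      case 0
      then show ?case by simp
    next
      case (Suc i)
      have "fps_nth G m = of_real (fps_nth (fps_X\<^sup>2 - fps_const (2 * c) * fps_X) m)" for m
        by (simp add: G_def fps_X_power_iff)
      with Suc show ?case
        by (simp add: fps_mult_nth)
    qed
    moreover have "(complex_of_real (-k)) gchoose i = of_real ((-k) gchoose i)" for i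
      by (simp add: gbinomial_prod_rev)
    ultimately show "fps_nth F j * of_real w ^ j = of_real (gegenbauer k j c * w ^ j)"
      by (simp add: F_def gegenbauer_def fps_compose_nth)
  qed
  finally show ?thesis
    by (simp only: sums_of_real_iff c_def)
qed

text \<open>
  Multi-indices on \<open>S\<close> of total degree \<open>N\<close>; they are taken extensional so that each one is
  counted once and the set is finite.
\<close>

definition multi_indices :: "'a set \<Rightarrow> nat \<Rightarrow> ('a \<Rightarrow> nat) set" where
  "multi_indices S N = {J \<in> S \<rightarrow>\<^sub>E UNIV. (\<Sum>s\<in>S. J s) = N}"

lemma finite_multi_indices:
  assumes "finite S"
  shows "finite (multi_indices S N)"
proof (rule finite_subset)
  show "multi_indices S N \<subseteq> S \<rightarrow>\<^sub>E {..N}"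
    using assms by (auto simp: multi_indices_def PiE_iff extensional_def intro: member_le_sum)
  show "finite (S \<rightarrow>\<^sub>E {..N})"
    using assms by (intro finite_PiE) auto
qed

end

theory Submission
  imports Defs
begin

text \<open>
  Put \<open>n = 2q\<close> and \<open>c = cos \<xi>\<close>.  Expanding each factor by the binomial series, the \<open>j\<close>-th inner sum
  times \<open>2 ^ (n j)\<close> is the coefficient of \<open>t ^ (n j)\<close> in \<open>P(t) ^ (-k)\<close>, where
  \<open>P(t) = (\<Prod>s=1..n. 1 - 2 b\<^sub>s t)\<close> (\<open>fps_nth_prod_multi_indices\<close>).

  The product \<open>P\<close> depends on \<open>\<xi>\<close> in a very simple way: \<open>P(t) = A(t) - 2 c t ^ n\<close> with a polynomial
  \<open>A\<close> not depending on \<open>\<xi>\<close> (\<open>prod_cos_linear_factors\<close>).  Indeed, at \<open>t = r / (1 + r\<^sup>2)\<close> the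
  factors become \<open>(1 - 2 r b\<^sub>s + r\<^sup>2) / (1 + r\<^sup>2)\<close>, and the product of the numerators is
  \<open>1 - 2 r ^ n c + r ^ (2n)\<close>, as one sees by splitting it over the complex \<open>n\<close>-th roots of
  \<open>exp (\<i> \<xi>)\<close>.

  Hence the coefficient of \<open>t ^ (n j)\<close> in \<open>P(t) ^ (-k)\<close> is a polynomial \<open>S\<^sub>j(c)\<close> of degree \<open>j\<close>,
  independent of \<open>\<xi>\<close>, whose leading coefficient \<open>2 ^ j (k)\<^sub>j / j!\<close> does not depend on \<open>n\<close> or \<open>A\<close>
  (\<open>neg_power_coeff_poly\<close>, proved by the recurrence that the differential equation
  \<open>B' P = - k P' B\<close> of \<open>B = P ^ (-k)\<close> gives for the coefficients of \<open>B\<close>).  The Gegenbauer polynomial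
  \<open>C\<^sub>M\<close> is the case \<open>n = 1\<close>, \<open>A = 1 + t\<^sup>2\<close> of the same statement, so it has degree \<open>M\<close> and the
  same leading coefficient as \<open>S\<^sub>M\<close>.  As \<open>k > 0\<close>, the leading coefficients are nonzero, so
  \<open>S\<^sub>0, \<dots>, S\<^sub>M\<close> is a basis of the polynomials of degree at most \<open>M\<close>; expanding \<open>C\<^sub>M\<close> in it
  gives the coefficients \<open>a\<^sub>j\<close>, and comparing leading coefficients gives \<open>a\<^sub>M = 1\<close>.
\<close>

section \<open>Real powers of formal power series\<close>

text \<open>
  \<open>neg_power k P B\<close> says that \<open>B\<close> is the formal power \<open>P ^ (-k)\<close>, for a series \<open>P\<close> with constant
  term \<open>1\<close>.  It is encoded as a relation: \<open>B\<close> has constant term \<open>1\<close> and logarithmic derivative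
  \<open>- k P' / P\<close>, which determines \<open>B\<close> and makes multiplicativity in \<open>P\<close> immediate.
\<close>

definition neg_power :: "real \<Rightarrow> real fps \<Rightarrow> real fps \<Rightarrow> bool" where
  "neg_power k P B \<longleftrightarrow> fps_nth P 0 = 1 \<and> fps_nth B 0 = 1 \<and>
     fps_deriv B * P = - (fps_const k * fps_deriv P * B)"

lemma neg_power_mult:
  assumes "neg_power k P B" and "neg_power k Q C"
  shows "neg_power k (P * Q) (B * C)"
proof -
  have "fps_deriv (B * C) * (P * Q) = (fps_deriv B * P) * (C * Q) + (fps_deriv C * Q) * (B * P)"
    by (simp add: algebra_simps)
  also have "\<dots> = - (fps_const k * fps_deriv P * B) * (C * Q)
      + - (fps_const k * fps_deriv Q * C) * (B * P)"
    using assms by (simp only: neg_power_def)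
  also have "\<dots> = - (fps_const k * fps_deriv (P * Q) * (B * C))"
    by (simp add: algebra_simps)
  finally show ?thesis
    using assms by (simp add: neg_power_def)
qed

lemma neg_power_prod:
  assumes "\<And>s. s \<in> S \<Longrightarrow> neg_power k (P s) (B s)"
  shows "neg_power k (\<Prod>s\<in>S. P s) (\<Prod>s\<in>S. B s)"
  using assms
proof (induction S rule: infinite_finite_induct)
  case (insert x S)
  then show ?case by (simp add: neg_power_mult)
qed (simp_all add: neg_power_def)

lemma neg_power_binomial:
  assumes "fps_nth g 0 = 0"
  shows "neg_power k (1 + g) (fps_compose (fps_binomial (-k)) g)"
proof -
  have "fps_deriv (fps_binomial (-k)) * (1 + fps_X) = fps_const (-k) * fps_binomial (-k)"
    by (simp add: fps_binomial_deriv fps_divide_unit mult.assoc inverse_mult_eq_1)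
  then have "fps_compose (fps_deriv (fps_binomial (-k)) * (1 + fps_X)) g
      = fps_compose (fps_const (-k) * fps_binomial (-k)) g"
    by simp
  then have ode: "fps_compose (fps_deriv (fps_binomial (-k))) g * (1 + g)
      = fps_const (-k) * fps_compose (fps_binomial (-k)) g"
    using assms by (simp only: fps_compose_mult_distrib fps_compose_add_distrib
        fps_X_fps_compose_startby0 fps_compose_1 fps_const_compose)
  have "fps_deriv (fps_compose (fps_binomial (-k)) g) * (1 + g)
      = fps_compose (fps_deriv (fps_binomial (-k))) g * (1 + g) * fps_deriv g"
    using assms by (simp add: fps_compose_deriv algebra_simps)
  also have "\<dots> = - (fps_const k * fps_deriv (1 + g) * fps_compose (fps_binomial (-k)) g)"
    unfolding ode by (simp add: algebra_simps flip: fps_const_neg)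
  finally show ?thesis
    using assms by (simp add: neg_power_def)
qed

lemma neg_power_linear:
  "neg_power k (1 - fps_const c * fps_X) (Abs_fps (\<lambda>i. pochhammer k i * c ^ i / fact i))"
proof -
  have sign: "(- c) ^ i * ((- 1) ^ i * x) = x * c ^ i" for x i
    by (subst mult.assoc[symmetric]) (simp flip: power_mult_distrib)
  have "fps_compose (fps_binomial (-k)) (fps_const (-c) * fps_X)
      = Abs_fps (\<lambda>i. pochhammer k i * c ^ i / fact i)"
    by (simp add: fps_compose_linear fps_eq_iff gbinomial_pochhammer sign)
  moreover have "1 + fps_const (-c) * fps_X = 1 - fps_const c * fps_X"
    by (simp flip: fps_const_neg)
  ultimately show ?thesis
    using neg_power_binomial[of "fps_const (-c) * fps_X" k] by (simp only: fps_mult_nth_0 fps_X_nth mult_zero_right if_False zero_neq_one refl simp_thms)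
qed

text \<open>
  This is the coefficient of \<open>X ^ N\<close> in \<open>X\<close> times the differential equation; it determines
  \<open>fps_nth B N\<close> from the earlier coefficients.
\<close>
lemma neg_power_rec:
  assumes "neg_power k P B" and "N > 0"
  shows "real N * fps_nth B N =
    - (\<Sum>i=1..N. fps_nth P i * (real (N - i) + k * real i) * fps_nth B (N - i))"
proof -
  \<comment> \<open>Multiplying by \<open>X\<close> avoids the index shift of the derivative.\<close>
  have XD: "fps_nth (fps_X * fps_deriv F) i = real i * fps_nth F i" for F :: "real fps" and i
    by (cases i) auto
  have "P * (fps_X * fps_deriv B) = - (fps_const k * ((fps_X * fps_deriv P) * B))"
    using assms(1) by (simp add: neg_power_def algebra_simps)
  then have "fps_nth (P * (fps_X * fps_deriv B)) N
      = fps_nth (- (fps_const k * ((fps_X * fps_deriv P) * B))) N"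
    by simp
  then have "(\<Sum>i=0..N. fps_nth P i * (real (N - i) * fps_nth B (N - i)))
      = - (k * (\<Sum>i=0..N. real i * fps_nth P i * fps_nth B (N - i)))"
    by (simp only: fps_neg_nth fps_mult_left_const_nth fps_mult_nth[of P] 
       fps_mult_nth[of "fps_X * fps_deriv P"] XD)
  then have "0 = (\<Sum>i=0..N. fps_nth P i * (real (N - i) * fps_nth B (N - i))) +
      k * (\<Sum>i=0..N. real i * fps_nth P i * fps_nth B (N - i))"
    by simp
  also have "\<dots> = (\<Sum>i=0..N. fps_nth P i * (real (N - i) + k * real i) * fps_nth B (N - i))"
    unfolding sum_distrib_left sum.distrib[symmetric]
    by (intro sum.cong refl) (simp only: ring_distribs mult_ac)
  also have "\<dots> = real N * fps_nth B N +
      (\<Sum>i=1..N. fps_nth P i * (real (N - i) + k * real i) * fps_nth B (N - i))"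
    using assms by (subst sum.atLeast_Suc_atMost) (auto simp: neg_power_def)
  finally show ?thesis by simp
qed


section \<open>Coefficients of powers of a series depending linearly on a parameter\<close>

text \<open>
  The coefficients of \<open>(A - 2 c X ^ n) ^ (-k)\<close> are polynomials in \<open>c\<close>.  In the recurrence only the
  term \<open>i = n\<close> involves \<open>c\<close>, so the degree can go up by one only every \<open>n\<close> steps, and the leading
  coefficient at \<open>X ^ (n j)\<close> comes from that term alone, whatever \<open>A\<close> is.
\<close>
lemma neg_power_coeff_poly:
  fixes A :: "real fps" and k :: real and n N :: nat
  assumes "n > 0"
  shows "\<exists>p. degree p \<le> N div n \<and>
    (\<forall>j. N = n * j \<longrightarrow> coeff p j = 2 ^ j * pochhammer k j / fact j) \<and>
    (\<forall>c B. neg_power k (A - fps_const (2 * c) * fps_X ^ n) B \<longrightarrow> fps_nth B N = poly p c)"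
proof (induction N rule: less_induct)
  case (less N)
  show ?case
  proof (cases "N = 0")
    case True
    then show ?thesis
      using assms by (intro exI[of _ 1]) (auto simp: neg_power_def)
  next
    case False
    obtain pp where deg: "\<And>m. m < N \<Longrightarrow> degree (pp m) \<le> m div n"
      and lead: "\<And>m j. m < N \<Longrightarrow> m = n * j \<Longrightarrow> coeff (pp m) j = 2 ^ j * pochhammer k j / fact j"
      and eval: "\<And>m c B. m < N \<Longrightarrow> neg_power k (A - fps_const (2 * c) * fps_X ^ n) B \<Longrightarrow>
                   fps_nth B m = poly (pp m) c"
      using less by metis
    \<comment> \<open>\<open>[:fps_nth A i, b i:]\<close> is the \<open>i\<close>-th coefficient of \<open>A - 2 c X ^ n\<close> as a polynomial in \<open>c\<close>.\<close>
    define b where "b = (\<lambda>i. if i = n then - 2 else 0 :: real)"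
    define T where "T = (\<lambda>i. smult (real (N - i) + k * real i) ([:fps_nth A i, b i:] * pp (N - i)))"
    define p where "p = smult (- 1 / real N) (\<Sum>i=1..N. T i)"
    have degT: "degree (T i) \<le> N div n" if i: "i \<in> {1..N}" for i
    proof -
      have "degree (T i) \<le> degree [:fps_nth A i, b i:] + degree (pp (N - i))"
        unfolding T_def by (meson degree_mult_le degree_smult_le le_trans)
      also have "\<dots> \<le> (if i = n then 1 else 0) + (N - i) div n"
        using i deg[of "N - i"] by (auto simp: b_def)
      also have "\<dots> \<le> N div n"
        using i assms by (auto simp: div_le_mono le_div_geq)
      finally show ?thesis .
    qed
    have "degree p \<le> N div n"
      unfolding p_def using degT by (intro order.trans[OF degree_smult_le] degree_sum_le) auto
    moreover have "coeff p j = 2 ^ j * pochhammer k j / fact j" if N: "N = n * j" for j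
    proof -
      obtain l where l: "j = Suc l" using False N by (cases j) auto
      have nN: "n \<in> {1..N}" using assms N l by auto
      have coeffT: "coeff (T i) j =
          (if i = n then - 2 * (real (N - n) + k * real n) * coeff (pp (N - n)) l else 0)"
        if i: "i \<in> {1..N}" for i
      proof -
        have "(N - i) div n < j"
          using i N nN assms by (simp add: div_less_iff_less_mult mult.commute[of j])
        then have "coeff (pp (N - i)) j = 0"
          using i deg[of "N - i"] by (intro coeff_eq_0) simp
        then show ?thesis
          by (auto simp: T_def b_def l coeff_pCons algebra_simps)
      qed
      have lN: "N - n = n * l" by (simp add: N l)
      have "coeff p j = - 1 / real N * (- 2 * (real (N - n) + k * real n) * coeff (pp (N - n)) l)"
        unfolding p_def using nN by (simp add: coeff_sum coeffT)
      also have "coeff (pp (N - n)) l = 2 ^ l * pochhammer k l / fact l"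
        using False assms lN by (intro lead) auto
      also have "- 1 / real N * (- 2 * (real (N - n) + k * real n) * (2 ^ l * pochhammer k l / fact l))
          = 2 * (k + real l) / real (Suc l) * (2 ^ l * pochhammer k l / fact l)"
      proof -
        have "- 1 / (x * y) * (- 2 * (x * z + k * x) * w) = 2 * (k + z) / y * w"
          if "x \<noteq> 0" "y \<noteq> 0" for x y z w :: real
          using that by (simp add: field_simps)
        from this[of "real n" "real (Suc l)" "real l"] show ?thesis
          unfolding lN of_nat_mult unfolding N l of_nat_mult using assms by auto
      qed
      also have "\<dots> = 2 ^ j * pochhammer k j / fact j"
        by (simp only: l pochhammer_Suc fact_Suc power_Suc times_divide_times_eq mult_ac)
      finally show ?thesis .
    qed
    moreover have "fps_nth B N = poly p c"
      if B: "neg_power k (A - fps_const (2 * c) * fps_X ^ n) B" for c B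
    proof -
      have "real N * fps_nth B N = - (\<Sum>i=1..N. poly (T i) c)"
        unfolding neg_power_rec[OF B False[THEN neq0_conv[THEN iffD1]]]
      proof (intro arg_cong[of _ _ uminus] sum.cong refl)
        fix i assume i: "i \<in> {1..N}"
        then have "fps_nth B (N - i) = poly (pp (N - i)) c"
          using eval B by simp
        then show "fps_nth (A - fps_const (2 * c) * fps_X ^ n) i * (real (N - i) + k * real i) *
            fps_nth B (N - i) = poly (T i) c"
          by (simp add: T_def b_def algebra_simps)
      qed
      then show ?thesis
        using False by (simp add: p_def poly_sum field_simps)
    qed
    ultimately show ?thesis by blast
  qed
qed

section \<open>The product of the linear factors\<close>

lemma prod_diff_roots_unity:
  fixes x y :: complex
  assumes "n > 0"
  shows "(\<Prod>s<n. x - y * cis (2 * pi * real s / real n)) = x ^ n - y ^ n"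
proof (cases "y = 0")
  case True
  then show ?thesis using assms by simp
next
  case False
  let ?z = "\<lambda>s. y * cis (2 * pi * real s / real n)"
  have "inj_on ?z {..<n}"
    using bij_betw_imp_inj_on[OF Complex.bij_betw_roots_unity[OF assms]] False by (simp add: inj_on_def)
  then have card: "card (?z ` {..<n}) = n"
    by (simp add: card_image)
  have "(\<Prod>s<n. [:- ?z s, 1:]) = monom 1 n - [:y ^ n:]"
  proof (rule poly_eqI_degree_lead_coeff[where n = n and A = "?z ` {..<n}"])
    have deg: "degree (\<Prod>s<n. [:- ?z s, 1:]) = n"
      by (subst degree_prod_eq_sum_degree) auto
    then show "degree (\<Prod>s<n. [:- ?z s, 1:]) \<le> n" by simp
    have "coeff (\<Prod>s<n. [:- ?z s, 1:]) n = 1"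
      using lead_coeff_prod[of "\<lambda>s. [:- ?z s, 1:]" "{..<n}"] deg by simp
    then show "coeff (\<Prod>s<n. [:- ?z s, 1:]) n = coeff (monom 1 n - [:y ^ n:]) n"
      using assms by (simp add: coeff_pCons split: nat.splits)
    show "degree (monom 1 n - [:y ^ n:]) \<le> n"
      by (intro degree_diff_le) (auto simp: degree_monom_le)
    fix z assume "z \<in> ?z ` {..<n}"
    then obtain s where s: "s < n" "z = ?z s" by auto
    have "?z s ^ n = y ^ n"
      using bij_betw_apply[OF Complex.bij_betw_roots_unity[OF assms], of s] s
      by (simp add: power_mult_distrib)
    moreover have "poly (\<Prod>s<n. [:- ?z s, 1:]) z = 0"
      using s by (auto simp: poly_prod)
    ultimately show "poly (\<Prod>s<n. [:- ?z s, 1:]) z = poly (monom 1 n - [:y ^ n:]) z"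
      using s by (simp add: poly_monom)
  qed (simp add: card)
  then have "poly (\<Prod>s<n. [:- ?z s, 1:]) x = poly (monom 1 n - [:y ^ n:]) x"
    by simp
  then show ?thesis
    by (simp add: poly_prod poly_monom)
qed

lemma cmod_one_minus_cis:
  "(cmod (1 - of_real r * cis t))\<^sup>2 = 1 - 2 * r * cos t + r\<^sup>2"
proof -
  have "(cmod (1 - of_real r * cis t))\<^sup>2 = (1 - r * cos t)\<^sup>2 + (r * sin t)\<^sup>2"
    by (simp add: cmod_power2)
  also have "\<dots> = 1 - 2 * r * cos t + r\<^sup>2 * ((cos t)\<^sup>2 + (sin t)\<^sup>2)"
    by (simp only: power2_eq_square ring_distribs) (simp add: algebra_simps)
  finally show ?thesis by simp
qed

lemma prod_cos_shifted:
  fixes r \<xi> :: real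
  assumes "n > 0"
  shows "(\<Prod>s=1..n. 1 - 2 * r * cos ((\<xi> + 2 * pi * real s) / real n) + r\<^sup>2)
    = 1 - 2 * r ^ n * cos \<xi> + (r ^ n)\<^sup>2"
proof -
  \<comment> \<open>The numbers \<open>r * cis ((\<xi> + 2 * pi * s) / n)\<close>, \<open>s = 1..n\<close>, are \<open>y\<close> times the \<open>n\<close>-th roots of
    unity; the extra \<open>2 * pi\<close> shifts the index range to \<open>s < n\<close>.\<close>
  define y where "y = of_real r * cis ((\<xi> + 2 * pi) / real n)"
  have "(\<Prod>s=1..n. 1 - of_real r * cis ((\<xi> + 2 * pi * real s) / real n))
      = (\<Prod>s<n. 1 - of_real r * cis ((\<xi> + 2 * pi * real (Suc s)) / real n))"
    unfolding One_nat_def by (rule prod.atLeast1_atMost_eq)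
  also have "\<dots> = (\<Prod>s<n. 1 - y * cis (2 * pi * real s / real n))"
    unfolding y_def mult.assoc cis_mult
    by (simp add: algebra_simps add_divide_distrib)
  also have "\<dots> = 1 ^ n - y ^ n"
    using assms by (rule prod_diff_roots_unity)
  also have "y ^ n = of_real (r ^ n) * cis \<xi>"
    using assms by (simp add: y_def power_mult_distrib Complex.DeMoivre complex_eq_iff)
  finally have *: "(\<Prod>s=1..n. 1 - of_real r * cis ((\<xi> + 2 * pi * real s) / real n))
      = 1 - of_real (r ^ n) * cis \<xi>" by simp
  show ?thesis
    unfolding cmod_one_minus_cis[symmetric] *[symmetric] prod_norm[symmetric] prod_power_distrib ..
qed

text \<open>
  The polynomial \<open>\<Prod>s. 1 - 2 b\<^sub>s t\<close> depends on the angle only through its term \<open>- 2 cos \<xi> t ^ n\<close>.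
\<close>
lemma prod_cos_linear_factors:
  fixes \<xi> \<eta> :: real
  assumes "n > 0"
  shows "(\<Prod>s=1..n. [:1, - 2 * cos ((\<xi> + 2 * pi * real s) / real n):]) + monom (2 * cos \<xi>) n
    = (\<Prod>s=1..n. [:1, - 2 * cos ((\<eta> + 2 * pi * real s) / real n):]) + monom (2 * cos \<eta>) n"
    (is "?Q \<xi> = ?Q \<eta>")
proof -
  define t where "t = (\<lambda>r::real. r / (1 + r\<^sup>2))"
  have pos: "1 + r\<^sup>2 > 0" for r :: real
    by (simp add: add_pos_nonneg)
  have eval: "poly (?Q \<theta>) (t r) = (1 + (r ^ n)\<^sup>2) / (1 + r\<^sup>2) ^ n" for \<theta> r
  proof -
    have "(\<Prod>s=1..n. 1 + t r * (- 2 * cos ((\<theta> + 2 * pi * real s) / real n)))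
        = (\<Prod>s=1..n. (1 - 2 * r * cos ((\<theta> + 2 * pi * real s) / real n) + r\<^sup>2) / (1 + r\<^sup>2))"
      unfolding t_def using pos[of r] by (intro prod.cong refl) (simp add: field_simps)
    also have "\<dots> = (1 - 2 * r ^ n * cos \<theta> + (r ^ n)\<^sup>2) / (1 + r\<^sup>2) ^ n"
      using assms by (simp only: prod_dividef prod_cos_shifted) simp
    finally have "poly (?Q \<theta>) (t r) = (1 - 2 * r ^ n * cos \<theta> + (r ^ n)\<^sup>2) / (1 + r\<^sup>2) ^ n
        + 2 * cos \<theta> * (r ^ n / (1 + r\<^sup>2) ^ n)"
      by (simp add: poly_prod poly_monom t_def power_divide)
    then show ?thesis
      by (simp flip: add_divide_distrib)
  qed
  \<comment> \<open>So the two polynomials agree at all \<open>t r\<close>, which are infinitely many points.\<close>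
  have "inj_on t {0<..<1}"
  proof (rule inj_onI)
    fix r s :: real assume rs: "r \<in> {0<..<1}" "s \<in> {0<..<1}" "t r = t s"
    then have "r * (1 + s\<^sup>2) = s * (1 + r\<^sup>2)"
      using pos[of r] pos[of s] by (simp add: t_def field_simps)
    then have "(r - s) * (1 - r * s) = 0"
      by (simp add: power2_eq_square algebra_simps)
    moreover have "r * s < 1"
      using rs mult_strict_mono[of r 1 s 1] by auto
    ultimately show "r = s" by simp
  qed
  then have "infinite (t ` {0<..<1})"
    by (simp add: finite_image_iff)
  moreover have "t ` {0<..<1} \<subseteq> {x. poly (?Q \<xi> - ?Q \<eta>) x = 0}"
    using eval[of \<xi>] eval[of \<eta>] by (auto simp only: poly_diff)
  ultimately have "?Q \<xi> - ?Q \<eta> = 0"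
    using poly_roots_finite finite_subset by blast
  then show ?thesis by (simp only: right_minus_eq)
qed

section \<open>Coefficients of a finite product of power series\<close>

lemma multi_indices_insert:
  assumes "finite S" and "x \<notin> S"
  shows "bij_betw (\<lambda>(i, J). J(x := i)) (SIGMA i:{0..N}. multi_indices S (N - i))
    (multi_indices (insert x S) N)"
proof (rule bij_betwI[where g = "\<lambda>J. (J x, J(x := undefined))"])
  have upd: "(\<Sum>s\<in>S. (J(x := i)) s) = (\<Sum>s\<in>S. J s)" for J :: "'a \<Rightarrow> nat" and i
    using assms by (intro sum.cong) auto
  have ext: "J(x := i) \<in> S \<rightarrow>\<^sub>E UNIV \<longleftrightarrow> i = undefined \<and> J \<in> insert x S \<rightarrow>\<^sub>E UNIV" for J :: "'a \<Rightarrow> nat" and i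
    using assms by (auto simp: PiE_iff extensional_def)
  have mem: "J \<in> multi_indices (insert x S) N \<longleftrightarrow>
      J \<in> insert x S \<rightarrow>\<^sub>E UNIV \<and> J x + (\<Sum>s\<in>S. J s) = N" for J :: "'a \<Rightarrow> nat"
    using assms by (simp add: multi_indices_def)
  show "(\<lambda>(i, J). J(x := i)) \<in> (SIGMA i:{0..N}. multi_indices S (N - i)) \<rightarrow>
      multi_indices (insert x S) N"
  proof (safe, unfold mem)
    fix i J assume "i \<in> {0..N}" "J \<in> multi_indices S (N - i)"
    then show "J(x := i) \<in> insert x S \<rightarrow>\<^sub>E UNIV \<and> (J(x := i)) x + (\<Sum>s\<in>S. (J(x := i)) s) = N"
      unfolding upd by (auto simp: multi_indices_def PiE_iff extensional_def)
  qed
  show "(\<lambda>J. (J x, J(x := undefined))) \<in> multi_indices (insert x S) N \<rightarrow>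
      (SIGMA i:{0..N}. multi_indices S (N - i))"
    unfolding multi_indices_def[of S] ext mem Pi_iff Ball_def mem_Sigma_iff mem_Collect_eq upd
    by auto
  fix J assume "J \<in> multi_indices (insert x S) N"
  then show "(case (J x, J(x := undefined)) of (i, J) \<Rightarrow> J(x := i)) = J"
    by simp
next
  fix iJ assume "iJ \<in> (SIGMA i:{0..N}. multi_indices S (N - i))"
  then show "((case iJ of (i, J) \<Rightarrow> J(x := i)) x, (case iJ of (i, J) \<Rightarrow> J(x := i))(x := undefined)) = iJ"
    using assms by (auto simp: multi_indices_def PiE_iff extensional_def fun_upd_idem)
qed

lemma fps_nth_prod_multi_indices:
  fixes F :: "'a \<Rightarrow> 'b :: comm_ring_1 fps"
  assumes "finite S"
  shows "fps_nth (\<Prod>s\<in>S. F s) N = (\<Sum>J\<in>multi_indices S N. \<Prod>s\<in>S. fps_nth (F s) (J s))"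
  using assms
proof (induction S arbitrary: N rule: finite_induct)
  case empty
  have "multi_indices {} N = (if N = 0 then {\<lambda>_::'a. undefined} else {})"
    by (auto simp: multi_indices_def)
  then show ?case by simp
next
  case (insert x S)
  have upd: "(\<Prod>s\<in>S. fps_nth (F s) ((J(x := i)) s)) = (\<Prod>s\<in>S. fps_nth (F s) (J s))"
    for J :: "'a \<Rightarrow> nat" and i
    using insert by (intro prod.cong) auto
  have "fps_nth (\<Prod>s\<in>insert x S. F s) N = (\<Sum>i=0..N. \<Sum>J\<in>multi_indices S (N - i).
      fps_nth (F x) i * (\<Prod>s\<in>S. fps_nth (F s) (J s)))"
    using insert by (simp add: fps_mult_nth sum_distrib_left)
  also have "\<dots> = (\<Sum>(i, J)\<in>(SIGMA i:{0..N}. multi_indices S (N - i)).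
      fps_nth (F x) i * (\<Prod>s\<in>S. fps_nth (F s) (J s)))"
    using insert by (subst sum.Sigma) (auto simp: finite_multi_indices)
  also have "\<dots> = (\<Sum>(i, J)\<in>(SIGMA i:{0..N}. multi_indices S (N - i)).
      \<Prod>s\<in>insert x S. fps_nth (F s) ((J(x := i)) s))"
    using insert by (intro sum.cong refl) (auto simp: upd simp del: fun_upd_apply, simp)
  also have "\<dots> = (\<Sum>J\<in>multi_indices (insert x S) N. \<Prod>s\<in>insert x S. fps_nth (F s) (J s))"
    using sum.reindex_bij_betw[OF multi_indices_insert[OF insert.hyps, of N],
        of "\<lambda>J. \<Prod>s\<in>insert x S. fps_nth (F s) (J s)"]
    by (simp only: case_prod_unfold)
  finally show ?case .
qed

section \<open>Expansion in a triangular family of polynomials\<close>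

lemma poly_triangular_expansion:
  fixes S :: "nat \<Rightarrow> 'a :: field poly"
  assumes "\<And>j. degree (S j) \<le> j" and "\<And>j. coeff (S j) j \<noteq> 0" and "degree p \<le> M"
  shows "\<exists>a. a M = coeff p M / coeff (S M) M \<and> p = (\<Sum>j=0..M. smult (a j) (S j))"
  using assms(3)
proof (induction M arbitrary: p)
  case 0
  then show ?case
    using assms(1)[of 0] assms(2)[of 0]
    by (intro exI[of _ "\<lambda>_. coeff p 0 / coeff (S 0) 0"]) (auto elim!: degree_eq_zeroE)
next
  case (Suc M)
  define u where "u = coeff p (Suc M) / coeff (S (Suc M)) (Suc M)"
  have "degree (p - smult u (S (Suc M))) \<le> M"
  proof (rule degree_le, intro allI impI)
    fix i assume "M < i"
    then consider "i = Suc M" | "i > Suc M" by linarith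
    then show "coeff (p - smult u (S (Suc M))) i = 0"
    proof cases
      case 1
      then show ?thesis using assms(2)[of "Suc M"] by (simp add: u_def)
    next
      case 2
      then show ?thesis
        using Suc.prems assms(1)[of "Suc M"] by (simp add: coeff_eq_0)
    qed
  qed
  then obtain a where "p - smult u (S (Suc M)) = (\<Sum>j=0..M. smult (a j) (S j))"
    using Suc.IH by blast
  then show ?case
    by (intro exI[of _ "a(Suc M := u)"]) (auto simp: u_def algebra_simps)
qed

section \<open>The expansion of the Gegenbauer polynomials\<close>

theorem corollary1:
  fixes q M :: nat and k :: real
  assumes "q \<ge> 1" and "k > 0"
  shows "\<exists>a :: nat \<Rightarrow> real. a M = 1 \<and>
    (\<forall>\<xi> \<in> {0..pi}.
      let b = (\<lambda>s::nat. cos ((\<xi> + 2 * pi * real s) / (2 * real q)))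
      in gegenbauer k M (cos \<xi>) =
        (\<Sum>j=0..M. a j * 2 ^ (2 * q * j) *
          (\<Sum>J \<in> multi_indices {1..2 * q} (2 * q * j).
             (\<Prod>s=1..2 * q. pochhammer k (J s)) * (\<Prod>s=1..2 * q. b s ^ J s / fact (J s)))))"
proof -
  define n where "n = 2 * q"
  have n: "n > 0" using assms by (simp add: n_def)
  define b where "b = (\<lambda>\<xi> s. cos ((\<xi> + 2 * pi * real s) / real n))"
  define L where "L = (\<lambda>\<xi>. \<Prod>s=1..n. [:1, - 2 * b \<xi> s:])"
  \<comment> \<open>Any reference angle will do; at the angle \<open>0\<close> the correction term is \<open>2 * cos 0 = 2\<close>.\<close>
  define A where "A = fps_of_poly (L 0 + monom 2 n)"
  define F where "F = (\<lambda>\<xi> s. Abs_fps (\<lambda>i. pochhammer k i * (2 * b \<xi> s) ^ i / fact i))"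
  have power: "neg_power k (A - fps_const (2 * cos \<xi>) * fps_X ^ n) (\<Prod>s=1..n. F \<xi> s)" for \<xi>
  proof -
    have "L \<xi> = L 0 + monom 2 n - monom (2 * cos \<xi>) n"
      using prod_cos_linear_factors[OF n, of \<xi> 0] by (simp add: L_def b_def algebra_simps)
    then have "fps_of_poly (L \<xi>) = A - fps_const (2 * cos \<xi>) * fps_X ^ n"
      by (simp only: A_def fps_of_poly_diff fps_of_poly_monom)
    moreover have "fps_of_poly (L \<xi>) = (\<Prod>s=1..n. 1 - fps_const (2 * b \<xi> s) * fps_X)"
      by (simp add: L_def fps_of_poly_prod fps_of_poly_linear' flip: fps_const_neg)
    moreover have "neg_power k (\<Prod>s=1..n. 1 - fps_const (2 * b \<xi> s) * fps_X) (\<Prod>s=1..n. F \<xi> s)"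
      unfolding F_def by (intro neg_power_prod neg_power_linear)
    ultimately show ?thesis by simp
  qed
  have "\<exists>p. degree p \<le> j \<and> coeff p j = 2 ^ j * pochhammer k j / fact j \<and>
      (\<forall>\<xi>. fps_nth (\<Prod>s=1..n. F \<xi> s) (n * j) = poly p (cos \<xi>))" for j
  proof -
    obtain p where "degree p \<le> n * j div n"
      and "n * j = n * j \<longrightarrow> coeff p j = 2 ^ j * pochhammer k j / fact j"
      and "\<And>c B. neg_power k (A - fps_const (2 * c) * fps_X ^ n) B \<Longrightarrow> fps_nth B (n * j) = poly p c"
      using neg_power_coeff_poly[OF n, of "n * j" k A] by blast
    then show ?thesis
      using n power by (intro exI[of _ p]) auto
  qed
  then obtain S where deg: "\<And>j. degree (S j) \<le> j"
    and lead: "\<And>j. coeff (S j) j = 2 ^ j * pochhammer k j / fact j"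
    and S: "\<And>j \<xi>. fps_nth (\<Prod>s=1..n. F \<xi> s) (n * j) = poly (S j) (cos \<xi>)"
    by metis
  have geg: "neg_power k (1 + fps_X\<^sup>2 - fps_const (2 * x) * fps_X ^ 1)
      (fps_compose (fps_binomial (-k)) (fps_X\<^sup>2 - fps_const (2 * x) * fps_X))" for x
    using neg_power_binomial[of "fps_X\<^sup>2 - fps_const (2 * x) * fps_X" k]
    by (simp add: add_diff_eq)
  obtain p where degp: "degree p \<le> M" and leadp: "coeff p M = 2 ^ M * pochhammer k M / fact M"
    and p: "\<And>x. gegenbauer k M x = poly p x"
    using neg_power_coeff_poly[of 1 M k "1 + fps_X\<^sup>2"] geg unfolding gegenbauer_def by auto
  have nz: "coeff (S j) j \<noteq> 0" for j
    using pochhammer_pos[OF assms(2), of j] by (simp add: lead)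
  obtain a where aM: "a M = coeff p M / coeff (S M) M"
    and a: "p = (\<Sum>j=0..M. smult (a j) (S j))"
    using poly_triangular_expansion[OF deg nz degp] by blast
  have inner: "poly (S j) (cos \<xi>) = 2 ^ (n * j) * (\<Sum>J \<in> multi_indices {1..n} (n * j).
      (\<Prod>s=1..n. pochhammer k (J s)) * (\<Prod>s=1..n. b \<xi> s ^ J s / fact (J s)))" for j \<xi>
  proof -
    have "(\<Prod>s=1..n. fps_nth (F \<xi> s) (J s)) =
        2 ^ (n * j) * ((\<Prod>s=1..n. pochhammer k (J s)) * (\<Prod>s=1..n. b \<xi> s ^ J s / fact (J s)))"
      if J: "J \<in> multi_indices {1..n} (n * j)" for J
    proof -
      have "(\<Sum>s=1..n. J s) = n * j"
        using J by (simp add: multi_indices_def)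
      then have "(2::real) ^ (n * j) = (\<Prod>s=1..n. 2 ^ J s)"
        by (metis power_sum)
      then show ?thesis
        by (simp add: F_def power_mult_distrib prod.distrib prod_dividef)
    qed
    then show ?thesis
      by (simp add: S[symmetric] fps_nth_prod_multi_indices sum_distrib_left)
  qed
  have "a M = 1"
    using aM nz[of M] by (simp add: lead leadp)
  moreover have "gegenbauer k M (cos \<xi>) = (\<Sum>j=0..M. a j * 2 ^ (n * j) *
      (\<Sum>J \<in> multi_indices {1..n} (n * j).
         (\<Prod>s=1..n. pochhammer k (J s)) * (\<Prod>s=1..n. b \<xi> s ^ J s / fact (J s))))" for \<xi>
    unfolding p a poly_sum poly_smult inner by (simp only: mult.assoc)
  ultimately show ?thesis
    by (intro exI[of _ a]) (simp add: n_def b_def Let_def)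
qed

end
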